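(* Let $\mathcal{H}$ be a complex infinite-dimensional Hilbert space and let $\mathbf{T}=(T_1,T_2)$ be a commuting pair of bounded linear operators on $\mathcal{H}$. Let $P:=\sqrt{T_1^*T_1+T_2^*T_2}$, let $T_i=V_iP$ ($i=1,2$) be the canonical joint polar decomposition of $\mathbf{T}$, and let $\widehat{\mathbf{T}}:=(\sqrt{P}V_1\sqrt{P},\sqrt{P}V_2\sqrt{P})$ be the spherical Aluthge transform of $\mathbf{T}$. Assume that $\mathbf{T}$ or $\widehat{\mathbf{T}}$ is left invertible. Then the operator $P$ is invertible.
   Context: Canonical joint polar decomposition: for a commuting pair $\mathbf{T}=(T_1,T_2)$ of bounded operators on $\mathcal{H}$, consider the polar decomposition of the column operator $\begin{pmatrix} T_1 \\ T_2 \end{pmatrix}:\mathcal{H}\to\mathcal{H}\oplus\mathcal{H}$, namely $\begin{pmatrix} T_1 \\ T_2 \end{pmatrix}=\begin{pmatrix} V_1 \\ V_2 \end{pmatrix}P$, where $P=\sqrt{T_1^*T_1+T_2^*T_2}$ and $\begin{pmatrix} V_1 \\ V_2 \end{pmatrix}:\mathcal{H}\to\mathcal{H}\oplus\mathcal{H}$ is a partial isometry, subject to $\ker T_1\cap\ker T_2=\ker V_1\cap\ker V_2=\ker P$. The spherical Aluthge transform of $\mathbf{T}$ is $\widehat{\mathbf{T}}:=(\sqrt{P}V_1\sqrt{P},\sqrt{P}V_2\sqrt{P})$, which is necessarily a commuting pair. For a commuting pair $\mathbf{S}=(S_1,S_2)$ on $\mathcal{H}$, the Koszul complex $K(\mathbf{S},\mathcal{H})$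 is $$0\to\mathcal{H}\xrightarrow{\begin{pmatrix} S_1 \\ S_2 \end{pmatrix}}\mathcal{H}\oplus\mathcal{H}\xrightarrow{(-S_2\ \ S_1)}\mathcal{H}\to 0.$$ The pair $\mathbf{S}$ is left invertible if this complex is exact at the left stage (i.e. the map $\begin{pmatrix} S_1 \\ S_2 \end{pmatrix}$ is injective) and the range of the corresponding boundary map $\begin{pmatrix} S_1 \\ S_2 \end{pmatrix}$ is closed. *)

theory Defs
  imports "HOL-Analysis.Analysis"
begin

section \<open>Complex Hilbert spaces\<close>

class complex_vector = real_vector +
  fixes scaleC :: "complex \<Rightarrow> 'a \<Rightarrow> 'a" (infixr "*\<^sub>C" 75)
  assumes scaleR_scaleC: "scaleR r x = complex_of_real r *\<^sub>C x"
    and scaleC_add_right: "a *\<^sub>C (x + y) = a *\<^sub>C x + a *\<^sub>C y"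
    and scaleC_add_left: "(a + b) *\<^sub>C x = a *\<^sub>C x + b *\<^sub>C x"
    and scaleC_scaleC: "a *\<^sub>C b *\<^sub>C x = (a * b) *\<^sub>C x"
    and scaleC_one: "1 *\<^sub>C x = x"

global_interpretation complex_vector: vector_space "scaleC :: complex \<Rightarrow> 'a \<Rightarrow> 'a::complex_vector"
  defines cspan = complex_vector.span
  by unfold_locales
    (simp_all add: scaleC_add_right scaleC_add_left scaleC_scaleC scaleC_one)

text \<open>The inner product is linear in the first argument. Definiteness comes from
  \<open>cinner_norm\<close>, because \<open>norm\<close> is a norm.\<close>

class complex_inner = complex_vector + real_normed_vector +
  fixes cinner :: "'a \<Rightarrow> 'a \<Rightarrow> complex"
  assumes cinner_commute: "cinner x y = cnj (cinner y x)"
    and cinner_add_left: "cinner (x + y) z = cinner x z + cinner y z"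
    and cinner_scaleC_left: "cinner (a *\<^sub>C x) y = a * cinner x y"
    and cinner_norm: "cinner x x = complex_of_real ((norm x)\<^sup>2)"

class complex_hilbert_space = complex_inner + complete_space

text \<open>The Hilbert space direct sum is the product type: the library's norm on pairs
  is the Euclidean one.\<close>

instantiation prod :: (complex_vector, complex_vector) complex_vector
begin

definition "c *\<^sub>C z = (c *\<^sub>C fst z, c *\<^sub>C snd z)"

instance
  by standard
    (simp_all add: scaleC_prod_def prod_eq_iff scaleR_scaleC scaleC_add_right
      scaleC_add_left scaleC_scaleC scaleC_one)

end

instantiation prod :: (complex_inner, complex_inner) complex_inner
begin

definition "cinner z w = cinner (fst z) (fst w) + cinner (snd z) (snd w)"

instance
proof
  fix x y z :: "'a \<times> 'b" and a :: complex
  show "cinner x y = cnj (cinner y x)"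
    unfolding cinner_prod_def complex_cnj_add by (metis cinner_commute)
  show "cinner (x + y) z = cinner x z + cinner y z"
    by (simp add: cinner_prod_def cinner_add_left)
  show "cinner (a *\<^sub>C x) y = a * cinner x y"
    by (simp add: cinner_prod_def scaleC_prod_def cinner_scaleC_left distrib_left)
  show "cinner x x = complex_of_real ((norm x)\<^sup>2)"
    by (simp add: cinner_prod_def cinner_norm norm_prod_def)
qed

end

instance prod :: (complex_hilbert_space, complex_hilbert_space) complex_hilbert_space ..


section \<open>Bounded operators\<close>

definition bounded_clinear :: "('a::complex_inner \<Rightarrow> 'b::complex_inner) \<Rightarrow> bool" where
  "bounded_clinear A \<longleftrightarrow> bounded_linear A \<and> (\<forall>c x. A (c *\<^sub>C x) = c *\<^sub>C A x)"

definition ker :: "('a \<Rightarrow> 'b::zero) \<Rightarrow> 'a set" where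
  "ker A = {x. A x = 0}"

definition cadjoint :: "('a::complex_inner \<Rightarrow> 'b::complex_inner) \<Rightarrow> 'b \<Rightarrow> 'a" where
  "cadjoint A = (THE B. \<forall>x y. cinner (A x) y = cinner x (B y))"

definition positive_op :: "('a::complex_inner \<Rightarrow> 'a) \<Rightarrow> bool" where
  "positive_op A \<longleftrightarrow> bounded_clinear A \<and> (\<forall>x. cinner (A x) x \<in> \<real>\<^sub>\<ge>\<^sub>0)"

text \<open>On a complex Hilbert space a positive operator has exactly one positive square
  root, so for positive \<open>A\<close> the choice below is not a choice.\<close>

definition op_sqrt :: "('a::complex_inner \<Rightarrow> 'a) \<Rightarrow> 'a \<Rightarrow> 'a" where
  "op_sqrt A = (SOME B. positive_op B \<and> B \<circ> B = A)"

definition invertible_op :: "('a::complex_inner \<Rightarrow> 'a) \<Rightarrow> bool" where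
  "invertible_op A \<longleftrightarrow>
    bounded_clinear A \<and> (\<exists>B. bounded_clinear B \<and> A \<circ> B = id \<and> B \<circ> A = id)"

definition partial_isometry :: "('a::complex_inner \<Rightarrow> 'b::complex_inner) \<Rightarrow> bool" where
  "partial_isometry W \<longleftrightarrow> bounded_clinear W \<and>
    (\<forall>x. (\<forall>y\<in>ker W. cinner x y = 0) \<longrightarrow> norm (W x) = norm x)"


section \<open>Pairs of operators\<close>

definition column :: "('a \<Rightarrow> 'a) \<Rightarrow> ('a \<Rightarrow> 'a) \<Rightarrow> 'a \<Rightarrow> 'a \<times> 'a" where
  "column S1 S2 x = (S1 x, S2 x)"

definition joint_modulus ::
  "('a::complex_inner \<Rightarrow> 'a) \<Rightarrow> ('a \<Rightarrow> 'a) \<Rightarrow> 'a \<Rightarrow> 'a" where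
  "joint_modulus T1 T2 = op_sqrt (\<lambda>x. cadjoint T1 (T1 x) + cadjoint T2 (T2 x))"

definition canonical_joint_polar_decomposition ::
  "('a::complex_inner \<Rightarrow> 'a) \<Rightarrow> ('a \<Rightarrow> 'a) \<Rightarrow> ('a \<Rightarrow> 'a) \<Rightarrow> ('a \<Rightarrow> 'a) \<Rightarrow> ('a \<Rightarrow> 'a) \<Rightarrow> bool" where
  "canonical_joint_polar_decomposition T1 T2 V1 V2 P \<longleftrightarrow>
    P = joint_modulus T1 T2 \<and>
    T1 = V1 \<circ> P \<and> T2 = V2 \<circ> P \<and>
    bounded_clinear V1 \<and> bounded_clinear V2 \<and>
    partial_isometry (column V1 V2) \<and>
    ker T1 \<inter> ker T2 = ker V1 \<inter> ker V2 \<and> ker V1 \<inter> ker V2 = ker P"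

text \<open>One component of the spherical Aluthge transform.\<close>

definition spherical_aluthge ::
  "('a::complex_inner \<Rightarrow> 'a) \<Rightarrow> ('a \<Rightarrow> 'a) \<Rightarrow> 'a \<Rightarrow> 'a" where
  "spherical_aluthge P V = op_sqrt P \<circ> V \<circ> op_sqrt P"

text \<open>\<open>column S1 S2\<close> is also the first boundary map of the Koszul complex of \<open>(S1, S2)\<close>;
  left invertibility concerns only this map.\<close>

definition left_invertible_pair ::
  "('a::complex_inner \<Rightarrow> 'a) \<Rightarrow> ('a \<Rightarrow> 'a) \<Rightarrow> bool" where
  "left_invertible_pair S1 S2 \<longleftrightarrow>
    inj (column S1 S2) \<and> closed (range (column S1 S2))"

end

theory Submission
  imports Defs
begin

text \<open>Left invertibility makes \<open>column S1 S2\<close> bounded below, by the open mapping theorem for injective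
  maps with closed range. If \<open>S\<^sub>i = T\<^sub>i = V\<^sub>i P\<close>, the lower bound passes to \<open>P\<close> because the \<open>V\<^sub>i\<close> are
  bounded. If \<open>S\<^sub>i\<close> is \<open>R V\<^sub>i R\<close> with \<open>R\<close> the square root of \<open>P\<close>, it passes to \<open>R\<close> and hence to
  \<open>P = R R\<close>. A positive operator bounded below is invertible: after scaling, \<open>1 - P\<close> is a strict
  contraction. That \<open>P\<close> and \<open>R\<close> are positive at all depends on the existence of adjoints and of positive
  square roots, since both are chosen by description operators.\<close>

instance complex_hilbert_space \<subseteq> banach ..

section \<open>Inner product calculus\<close>

lemma cinner_add_right: "cinner x (y + z) = cinner x y + cinner x z"
  by (metis cinner_add_left cinner_commute complex_cnj_add)

lemma cinner_scaleC_right: "cinner x (a *\<^sub>C y) = cnj a * cinner x y"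
  by (metis cinner_commute cinner_scaleC_left complex_cnj_mult)

lemma Re_cinner_same: "Re (cinner x x) = (norm x)\<^sup>2"
  by (simp add: cinner_norm)

lemma Re_cinner_commute: "Re (cinner x y) = Re (cinner y x)"
  by (metis cinner_commute cnj.sel(1))

lemma norm_add_power2:
  fixes x y :: "'a::complex_inner"
  shows "(norm (x + y))\<^sup>2 = (norm x)\<^sup>2 + (norm y)\<^sup>2 + 2 * Re (cinner x y)"
proof -
  have "(norm (x + y))\<^sup>2 = Re (cinner (x + y) (x + y))"
    by (simp only: Re_cinner_same)
  also have "\<dots> = Re (cinner x x) + Re (cinner y y) + Re (cinner x y) + Re (cinner y x)"
    by (simp add: cinner_add_left cinner_add_right)
  finally show ?thesis
    by (simp add: Re_cinner_same Re_cinner_commute[of y x])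
qed

lemma norm_scaleC: "norm (a *\<^sub>C x) = cmod a * norm (x::'a::complex_inner)"
proof -
  have "complex_of_real ((norm (a *\<^sub>C x))\<^sup>2) = complex_of_real ((cmod a * norm x)\<^sup>2)"
    unfolding cinner_norm[symmetric] cinner_scaleC_left cinner_scaleC_right
    by (simp add: cinner_norm power_mult_distrib complex_norm_square[of a] del: of_real_power)
  then show ?thesis
    by (simp only: of_real_eq_iff power2_eq_iff_nonneg norm_ge_zero mult_nonneg_nonneg)
qed

text \<open>The triangle inequality comes with the norm, so squaring and expanding it yields the
  real part of Cauchy-Schwarz, reversing the usual derivation.\<close>

lemma Re_cinner_le: "Re (cinner x y) \<le> norm x * norm (y::'a::complex_inner)"
proof -
  have "(norm (x + y))\<^sup>2 \<le> (norm x + norm y)\<^sup>2"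
    by (simp add: norm_triangle_ineq power_mono)
  then show ?thesis
    by (simp add: norm_add_power2 power2_sum)
qed

text \<open>Multiplying \<open>x\<close> by a unimodular scalar \<open>a\<close> makes the inner
  product real and nonnegative, which reduces the claim to its real part.\<close>

lemma Cauchy_Schwarz_cinner: "cmod (cinner x y) \<le> norm x * norm (y::'a::complex_inner)"
proof (cases "cinner x y = 0")
  case False
  define a where "a = cnj (cinner x y) / cmod (cinner x y)"
  have "cmod a = 1"
    using False by (simp add: a_def norm_divide)
  have "cinner (a *\<^sub>C x) y = cmod (cinner x y)"
    using False
    by (simp add: a_def cinner_scaleC_left mult.commute complex_norm_square[symmetric] power2_eq_square)
  then show ?thesis
    using Re_cinner_le[of "a *\<^sub>C x" y] \<open>cmod a = 1\<close> by (simp add: norm_scaleC)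
qed simp

text \<open>Over the reals the sesquilinear form is bilinear; this view supplies the rules for
  differences and limits of inner products.\<close>

interpretation cinner: bounded_bilinear "cinner :: 'a::complex_inner \<Rightarrow> 'a \<Rightarrow> complex"
proof
  fix r and x y :: 'a
  show "cinner (r *\<^sub>R x) y = r *\<^sub>R cinner x y" "cinner x (r *\<^sub>R y) = r *\<^sub>R cinner x y"
    by (simp_all add: scaleR_scaleC cinner_scaleC_left cinner_scaleC_right scaleR_conv_of_real)
next
  show "\<exists>K. \<forall>x y::'a. cmod (cinner x y) \<le> norm x * norm y * K"
    by (intro exI[of _ 1]) (simp add: Cauchy_Schwarz_cinner)
qed (rule cinner_add_left cinner_add_right)+

lemma cinner_eqI:
  assumes "\<And>z. cinner z x = cinner z y"
  shows "x = (y::'a::complex_inner)"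
proof -
  have "cinner (x - y) (x - y) = 0"
    by (simp add: cinner.diff_right assms)
  then show ?thesis
    by (simp add: cinner_norm)
qed

lemma norm_diff_power2:
  fixes x y :: "'a::complex_inner"
  shows "(norm (x - y))\<^sup>2 = (norm x)\<^sup>2 + (norm y)\<^sup>2 - 2 * Re (cinner x y)"
  using norm_add_power2[of x "-y"] by (simp add: cinner.minus_right)

section \<open>The adjoint\<close>

lemma riesz_representation_Re:
  fixes g :: "'a::complex_hilbert_space \<Rightarrow> real"
  assumes "bounded_linear g"
  shows "\<exists>z. \<forall>x. g x = Re (cinner x z)"
proof -
  interpret g: bounded_linear g by fact
  \<comment> \<open>The representing vector minimises \<open>q\<close>, since \<open>q x = (norm (x - z))\<^sup>2 - (norm z)\<^sup>2\<close> for it.\<close>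
  define q where "q x = (norm x)\<^sup>2 - 2 * g x" for x
  obtain K where K: "\<And>x. \<bar>g x\<bar> \<le> norm x * K"
    using g.bounded by auto
  have "- K\<^sup>2 \<le> q x" for x
    using K[of x] zero_le_power2[of "norm x - K"] by (simp add: q_def power2_diff)
  then have bdd: "bdd_below (range q)"
    by (intro bdd_belowI2)
  define m where "m = Inf (range q)"
  have m_le: "m \<le> q x" for x
    unfolding m_def using bdd by (simp add: cInf_lower)
  have "\<exists>x. q x < m + inverse (real (Suc n))" for n
    using cInf_lessD[of "range q" "m + inverse (real (Suc n))"] unfolding m_def by auto
  then obtain u where u: "\<And>n. q (u n) < m + inverse (real (Suc n))"
    by metis
  \<comment> \<open>The parallelogram law, with the value of \<open>q\<close> at the midpoint
    bounded below by \<open>m\<close>; it forces minimising sequences to be Cauchy.\<close>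
  have parallelogram: "(norm (x - y))\<^sup>2 \<le> 2 * q x + 2 * q y - 4 * m" for x y
  proof -
    have "q ((1/2) *\<^sub>R (x + y)) = (norm (x + y))\<^sup>2 / 4 - g x - g y"
      by (simp add: q_def g.scaleR g.add power_divide add_divide_distrib del: scaleR_right_distrib)
    then have "(norm (x + y))\<^sup>2 / 4 - g x - g y \<ge> m"
      using m_le by metis
    then show ?thesis
      unfolding q_def norm_add_power2 norm_diff_power2 by argo
  qed
  have "Cauchy u"
  proof (rule CauchyI)
    fix e :: real assume "0 < e"
    \<comment> \<open>Each of the two values of \<open>q\<close> exceeds \<open>m\<close> by less
      than \<open>e\<^sup>2 / 4\<close> and is counted twice, for a total below
      \<open>e\<^sup>2\<close>.\<close>
    then obtain N where N: "inverse (real (Suc N)) < e\<^sup>2 / 4"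
      using reals_Archimedean[of "e\<^sup>2 / 4"] by auto
    have "norm (u i - u j) < e" if "i \<ge> N" "j \<ge> N" for i j
    proof -
      have "inverse (real (Suc i)) \<le> inverse (real (Suc N))" "inverse (real (Suc j)) \<le> inverse (real (Suc N))"
        using that by (simp_all add: le_imp_inverse_le)
      then have "(norm (u i - u j))\<^sup>2 < e\<^sup>2"
        using parallelogram[of "u i" "u j"] u[of i] u[of j] N
        by linarith
      then show ?thesis
        using \<open>0 < e\<close> by (simp add: power_less_imp_less_base)
    qed
    then show "\<exists>M. \<forall>m\<ge>M. \<forall>n\<ge>M. norm (u m - u n) < e"
      by blast
  qed
  then obtain z where z: "u \<longlonglongrightarrow> z"
    by (auto simp: Cauchy_convergent_iff convergent_def)
  have "(\<lambda>n. q (u n)) \<longlonglongrightarrow> q z"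
    unfolding q_def by (intro tendsto_intros g.tendsto z)
  moreover have "(\<lambda>n. m + inverse (real (Suc n))) \<longlonglongrightarrow> m + 0"
    using LIMSEQ_inverse_real_of_nat by (intro tendsto_add tendsto_const)
  ultimately have "q z \<le> m + 0"
    by (rule LIMSEQ_le) (use u in \<open>blast intro: less_imp_le\<close>)
  then have "q z \<le> m" by simp
  \<comment> \<open>Variation of \<open>q\<close> at its minimiser \<open>z\<close> in direction
    \<open>h\<close>: a quadratic in \<open>t\<close> that is never negative, so its linear
    coefficient must vanish.\<close>
  have key: "0 \<le> t * (2 * Re (cinner h z) - 2 * g h) + t\<^sup>2 * (norm h)\<^sup>2" for t h
  proof -
    have "q z \<le> q (z + t *\<^sub>R h)"
      using \<open>q z \<le> m\<close> m_le order_trans by blast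
    then show ?thesis
      by (simp add: q_def norm_add_power2 g.add g.scaleR cinner.scaleR_right Re_cinner_commute[of z]
          power_mult_distrib algebra_simps)
  qed
  have "g h = Re (cinner h z)" for h
  proof (rule ccontr)
    define d where "d = 2 * Re (cinner h z) - 2 * g h"
    assume "g h \<noteq> Re (cinner h z)"
    then have "d \<noteq> 0" by (simp add: d_def)
    have "h \<noteq> 0"
      using \<open>d \<noteq> 0\<close> by (auto simp: d_def g.zero cinner.zero_left)
    \<comment> \<open>The parameter \<open>t = - d / (2 * (norm h)\<^sup>2)\<close> minimises the
      quadratic and makes it negative.\<close>
    have "0 \<le> - (d\<^sup>2 / (2 * (norm h)\<^sup>2)) + (d / (2 * (norm h)\<^sup>2))\<^sup>2 * (norm h)\<^sup>2"
      using key[of "- d / (2 * (norm h)\<^sup>2)" h] by (simp add: d_def[symmetric] power2_eq_square)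
    also have "\<dots> = - (d\<^sup>2 / (4 * (norm h)\<^sup>2))"
      using \<open>h \<noteq> 0\<close> by (simp add: power2_eq_square field_simps)
    also have "\<dots> < 0"
      using \<open>d \<noteq> 0\<close> \<open>h \<noteq> 0\<close> by simp
    finally show False by simp
  qed
  then show ?thesis by blast
qed

text \<open>A complex linear functional is determined by its real part: evaluating at
  \<open>\<i> *\<^sub>C x\<close> recovers the imaginary part.\<close>

lemma riesz_representation:
  fixes f :: "'a::complex_hilbert_space \<Rightarrow> complex"
  assumes "bounded_linear f" and f_scale: "\<And>c x. f (c *\<^sub>C x) = c * f x"
  shows "\<exists>z. \<forall>x. f x = cinner x z"
proof -
  have "bounded_linear (\<lambda>x. Re (f x))"
    using bounded_linear_compose[OF bounded_linear_Re assms(1)] by (simp add: comp_def)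
  then obtain z where z: "\<And>x. Re (f x) = Re (cinner x z)"
    using riesz_representation_Re by blast
  have "Im (f x) = Im (cinner x z)" for x
    using z[of "\<i> *\<^sub>C x"] by (simp add: f_scale cinner_scaleC_left)
  with z have "f x = cinner x z" for x
    by (simp add: complex_eq_iff)
  then show ?thesis by blast
qed

lemma bounded_clinearD:
  assumes "bounded_clinear A"
  shows "bounded_linear A" and "A (c *\<^sub>C x) = c *\<^sub>C A x"
  using assms by (auto simp: bounded_clinear_def)

text \<open>Riesz representation, applied for each \<open>y\<close>, gives existence, and testing
  against all vectors gives uniqueness; so the definite description denotes the adjoint.\<close>

lemma cinner_cadjoint:
  fixes T :: "'a::complex_hilbert_space \<Rightarrow> 'b::complex_inner"
  assumes "bounded_clinear T"
  shows "cinner (T x) y = cinner x (cadjoint T y)"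
proof -
  have "\<exists>z. \<forall>x. cinner (T x) y = cinner x z" for y
    using bounded_linear_compose[OF cinner.bounded_linear_left bounded_clinearD(1)[OF assms]]
    by (intro riesz_representation)
      (simp_all add: bounded_clinearD(2)[OF assms] cinner_scaleC_left)
  then obtain B where B: "\<And>x y. cinner (T x) y = cinner x (B y)"
    by metis
  have "cadjoint T = B"
    unfolding cadjoint_def
  proof (rule the_equality)
    fix B' assume "\<forall>x y. cinner (T x) y = cinner x (B' y)"
    then show "B' = B"
      using B by (intro ext cinner_eqI) simp
  qed (simp add: B)
  with B show ?thesis by simp
qed

lemma bounded_clinear_cadjoint:
  fixes T :: "'a::complex_hilbert_space \<Rightarrow> 'b::complex_inner"
  assumes T: "bounded_clinear T"
  shows "bounded_clinear (cadjoint T)"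
proof -
  note adj = cinner_cadjoint[OF T, symmetric]
  obtain K where "0 \<le> K" and K: "\<And>x. norm (T x) \<le> norm x * K"
    using bounded_linear.nonneg_bounded[OF bounded_clinearD(1)[OF T]] by auto
  have "bounded_linear (cadjoint T)"
  proof (rule bounded_linear_intro)
    fix x y :: 'b and r :: real
    show "cadjoint T (x + y) = cadjoint T x + cadjoint T y"
      by (rule cinner_eqI) (simp add: adj cinner.add_right)
    show "cadjoint T (r *\<^sub>R x) = r *\<^sub>R cadjoint T x"
      by (rule cinner_eqI) (simp add: adj cinner.scaleR_right)
    let ?z = "cadjoint T x"
    \<comment> \<open>The left side is the inner product of \<open>T ?z\<close> with
      \<open>x\<close>. Bounding it and cancelling one factor \<open>norm ?z\<close> shows that the
      adjoint inherits the bound \<open>K\<close>.\<close>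
    have "(norm ?z)\<^sup>2 \<le> norm (T ?z) * norm x"
      using Re_cinner_le[of "T ?z" x] by (simp add: Re_cinner_same adj[symmetric])
    also have "\<dots> \<le> norm ?z * K * norm x"
      by (simp add: K mult_right_mono)
    finally have "norm ?z * norm ?z \<le> norm ?z * (norm x * K)"
      by (simp add: power2_eq_square mult_ac)
    then show "norm ?z \<le> norm x * K"
      using \<open>0 \<le> K\<close> by (cases "?z = 0") auto
  qed
  moreover have "cadjoint T (c *\<^sub>C x) = c *\<^sub>C cadjoint T x" for c x
    by (rule cinner_eqI) (simp add: adj cinner_scaleC_right)
  ultimately show ?thesis
    by (simp add: bounded_clinear_def)
qed

section \<open>Positive operators and their square roots\<close>

lemma bounded_clinear_scaleR:
  assumes "bounded_clinear A"
  shows "bounded_clinear (\<lambda>x. r *\<^sub>R A x)"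
proof -
  have "bounded_linear (\<lambda>x. r *\<^sub>R A x)"
    by (rule bounded_linear_const_scaleR) (rule bounded_clinearD(1)[OF assms])
  then show ?thesis
    by (simp add: bounded_clinear_def bounded_clinearD(2)[OF assms] scaleR_scaleC scaleC_scaleC mult.commute)
qed

lemma positive_op_scaleR:
  assumes "positive_op A" "0 \<le> r"
  shows "positive_op (\<lambda>x. r *\<^sub>R A x)"
  using assms unfolding positive_op_def
  by (simp add: bounded_clinear_scaleR cinner.scaleR_left complex_nonneg_Reals_iff)

text \<open>Polarisation: the form is real at \<open>x + y\<close>, which relates the imaginary
  parts of the two mixed terms; replacing \<open>y\<close> by \<open>\<i> *\<^sub>C y\<close>
  relates the real parts.\<close>

lemma positive_op_selfadjoint:
  assumes "positive_op A"
  shows "cinner (A x) y = cinner x (A y)"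
proof -
  have bl: "bounded_linear A" and sc: "\<And>c x. A (c *\<^sub>C x) = c *\<^sub>C A x"
    and real: "\<And>x. Im (cinner (A x) x) = 0"
    using assms by (auto simp: positive_op_def bounded_clinear_def complex_nonneg_Reals_iff)
  have "Im (cinner (A x) y) + Im (cinner (A y) x) = 0" for x y
    using real[of "x + y"] real[of x] real[of y]
    by (simp add: linear_add[OF bounded_linear.linear[OF bl]] cinner_add_left cinner_add_right)
  from this[of x y] this[of x "\<i> *\<^sub>C y"] have "cinner (A x) y = cnj (cinner (A y) x)"
    by (simp add: sc cinner_scaleC_left cinner_scaleC_right complex_eq_iff)
  then show ?thesis
    by (metis cinner_commute)
qed

text \<open>This is the operator inequality \<open>A\<^sup>2 \<le> A\<close> for positive
  contractions. It follows from positivity of the form at \<open>x - A x\<close>, without appeal to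
  a square root of \<open>A\<close>.\<close>

lemma positive_op_norm_le_form:
  assumes A: "positive_op A" and contr: "\<And>x. norm (A x) \<le> norm x"
  shows "(norm (A x))\<^sup>2 \<le> Re (cinner (A x) x)"
proof -
  have lin: "linear A" and nonneg: "\<And>x. 0 \<le> Re (cinner (A x) x)"
    using A by (auto simp: positive_op_def bounded_clinear_def complex_nonneg_Reals_iff
        bounded_linear.linear)
  have "0 \<le> Re (cinner (A (x - A x)) (x - A x))"
    by (rule nonneg)
  also have "\<dots> = Re (cinner (A x) x) - 2 * (norm (A x))\<^sup>2 + Re (cinner (A (A x)) (A x))"
    by (simp add: linear_diff[OF lin] cinner.diff_left cinner.diff_right Re_cinner_same
        positive_op_selfadjoint[OF A, of "A x" x])
  also have "Re (cinner (A (A x)) (A x)) \<le> norm (A (A x)) * norm (A x)"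
    by (rule Re_cinner_le)
  also have "\<dots> \<le> (norm (A x))\<^sup>2"
    by (simp add: contr mult_right_mono power2_eq_square)
  finally show ?thesis by simp
qed

text \<open>This serves twice: it makes \<open>1 - A\<close> a contraction, as the square root
  iteration requires, and a strict one once \<open>A\<close> is bounded below.\<close>

lemma positive_op_norm_complement:
  assumes "positive_op A" and "\<And>x. norm (A x) \<le> norm x"
  shows "(norm (x - A x))\<^sup>2 \<le> (norm x)\<^sup>2 - (norm (A x))\<^sup>2"
  using positive_op_norm_le_form[OF assms, of x]
  by (simp add: norm_diff_power2 Re_cinner_commute[of x])

lemma bounded_clinear_pos_bound:
  assumes "bounded_clinear A"
  obtains K where "0 < K" "\<And>x. norm (A x) \<le> K * norm x"
  using bounded_linear.pos_bounded[OF bounded_clinearD(1)[OF assms]] by (metis mult.commute)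

text \<open>Writing the root of \<open>A\<close> as \<open>1 - Y\<close>, the equation \<open>(1 - Y)\<^sup>2 = A\<close> becomes the fixed point
  equation \<open>Y = (C + Y\<^sup>2) / 2\<close> with \<open>C = 1 - A\<close>. When \<open>norm C \<le> 1\<close> the increments of the iteration
  are dominated by those of the scalar iteration \<open>sqrt_bound\<close> for \<open>C = 1\<close>.\<close>

primrec sqrt_iter :: "('a::real_normed_vector \<Rightarrow>\<^sub>L 'a) \<Rightarrow> nat \<Rightarrow> ('a \<Rightarrow>\<^sub>L 'a)" where
  "sqrt_iter C 0 = 0"
| "sqrt_iter C (Suc n) = (1/2) *\<^sub>R (C + (sqrt_iter C n o\<^sub>L sqrt_iter C n))"

primrec sqrt_bound :: "nat \<Rightarrow> real" where
  "sqrt_bound 0 = 0"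
| "sqrt_bound (Suc n) = (1 + (sqrt_bound n)\<^sup>2) / 2"

lemma sqrt_bound_bounds: "0 \<le> sqrt_bound n" "sqrt_bound n \<le> 1"
  by (induction n) (auto simp: abs_square_le_1)

text \<open>The increment equals \<open>(1 - sqrt_bound n)\<^sup>2 / 2\<close>.\<close>

lemma sqrt_bound_mono: "sqrt_bound n \<le> sqrt_bound (Suc n)"
  using zero_le_power2[of "1 - sqrt_bound n"] by (simp add: power2_diff)

lemma Cauchy_sqrt_bound: "Cauchy sqrt_bound"
proof -
  have "incseq sqrt_bound"
    using sqrt_bound_mono by (rule incseq_SucI)
  then obtain l where "sqrt_bound \<longlonglongrightarrow> l"
    using incseq_convergent[of sqrt_bound 1] sqrt_bound_bounds(2) by metis
  then show ?thesis by (rule LIMSEQ_imp_Cauchy)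
qed

lemma norm_sqrt_iter:
  assumes "norm C \<le> 1"
  shows "norm (sqrt_iter C n) \<le> sqrt_bound n"
proof (induction n)
  case (Suc n)
  have "norm (sqrt_iter C n o\<^sub>L sqrt_iter C n) \<le> norm (sqrt_iter C n) * norm (sqrt_iter C n)"
    by (rule norm_blinfun_compose)
  also have "\<dots> \<le> (sqrt_bound n)\<^sup>2"
    unfolding power2_eq_square using Suc.IH by (intro mult_mono) (auto simp: sqrt_bound_bounds)
  finally show ?case
    using assms norm_triangle_ineq[of C "sqrt_iter C n o\<^sub>L sqrt_iter C n"] by simp
qed simp

lemma norm_sqrt_iter_Suc_diff:
  assumes "norm C \<le> 1"
  shows "norm (sqrt_iter C (Suc n) - sqrt_iter C n) \<le> sqrt_bound (Suc n) - sqrt_bound n"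
proof (induction n)
  case 0
  show ?case using assms by simp
next
  case (Suc n)
  define X Y where "X = sqrt_iter C (Suc n)" and "Y = sqrt_iter C n"
  define s t where "s = sqrt_bound (Suc n)" and "t = sqrt_bound n"
  \<comment> \<open>The noncommutative difference of squares; its two terms match those in
    \<open>s\<^sup>2 - t\<^sup>2 = s * (s - t) + (s - t) * t\<close>.\<close>
  have "(X o\<^sub>L X) - (Y o\<^sub>L Y) = (X o\<^sub>L (X - Y)) + ((X - Y) o\<^sub>L Y)"
    by (rule blinfun_eqI) (simp add: blinfun.bilinear_simps)
  then have "norm ((X o\<^sub>L X) - (Y o\<^sub>L Y)) \<le> norm X * norm (X - Y) + norm (X - Y) * norm Y"
    by (simp only:) (intro norm_triangle_le add_mono norm_blinfun_compose)
  also have "\<dots> \<le> s * (s - t) + (s - t) * t"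
    using norm_sqrt_iter[OF assms] Suc.IH sqrt_bound_bounds
    unfolding X_def Y_def s_def t_def
    by (intro add_mono mult_mono)
      (auto simp: sqrt_bound_mono simp del: sqrt_iter.simps sqrt_bound.simps)
  also have "\<dots> = s\<^sup>2 - t\<^sup>2"
    by (simp add: power2_eq_square algebra_simps)
  finally have bound: "norm ((X o\<^sub>L X) - (Y o\<^sub>L Y)) \<le> s\<^sup>2 - t\<^sup>2" .
  have "sqrt_iter C (Suc (Suc n)) - sqrt_iter C (Suc n) =
      (1/2) *\<^sub>R (C + (X o\<^sub>L X)) - (1/2) *\<^sub>R (C + (Y o\<^sub>L Y))"
    by (simp add: X_def Y_def)
  also have "\<dots> = (1/2) *\<^sub>R ((X o\<^sub>L X) - (Y o\<^sub>L Y))"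
    by (simp add: algebra_simps)
  finally have "norm (sqrt_iter C (Suc (Suc n)) - sqrt_iter C (Suc n)) \<le> (s\<^sup>2 - t\<^sup>2) / 2"
    using bound by simp
  also have "\<dots> = sqrt_bound (Suc (Suc n)) - sqrt_bound (Suc n)"
    by (simp add: s_def t_def diff_divide_distrib add_divide_distrib)
  finally show ?case .
qed

text \<open>Telescoping the increment bounds compares all distances with those of
  \<open>sqrt_bound\<close>, so its Cauchy property transfers, including in the borderline case
  \<open>norm C = 1\<close>.\<close>

lemma convergent_sqrt_iter:
  fixes C :: "'a::banach \<Rightarrow>\<^sub>L 'a"
  assumes "norm C \<le> 1"
  shows "convergent (sqrt_iter C)"
proof -
  have diff: "norm (sqrt_iter C (m + k) - sqrt_iter C m) \<le> sqrt_bound (m + k) - sqrt_bound m" for m k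
  proof (induction k)
    case (Suc k)
    then show ?case
      using norm_sqrt_iter_Suc_diff[OF assms, of "m + k"]
        norm_triangle_ineq[of "sqrt_iter C (Suc (m + k)) - sqrt_iter C (m + k)" "sqrt_iter C (m + k) - sqrt_iter C m"]
      by (simp del: sqrt_iter.simps sqrt_bound.simps)
  qed simp
  have "dist (sqrt_iter C m) (sqrt_iter C n) \<le> dist (sqrt_bound m) (sqrt_bound n)" for m n
  proof (induction m n rule: linorder_wlog)
    case (le m n)
    then show ?case
      using diff[of m "n - m"] by (simp add: dist_norm norm_minus_commute)
  qed (simp add: dist_commute)
  then have "Cauchy (sqrt_iter C)"
    using Cauchy_sqrt_bound unfolding Cauchy_def by (meson le_less_trans)
  then show ?thesis
    by (simp add: Cauchy_convergent_iff)
qed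

text \<open>Supplies the continuity with which complex homogeneity passes to limits.\<close>

lemma bounded_clinear_scaleC: "bounded_clinear ((*\<^sub>C) c :: 'a::complex_inner \<Rightarrow> 'a)"
proof -
  have "bounded_linear ((*\<^sub>C) c :: 'a \<Rightarrow> 'a)"
    by (rule bounded_linear_intro[of _ "cmod c"])
      (simp_all add: scaleC_add_right scaleR_scaleC scaleC_scaleC norm_scaleC mult.commute)
  then show ?thesis
    by (simp add: bounded_clinear_def scaleC_scaleC mult.commute)
qed

lemma positive_op_sqrt_exists_contraction:
  fixes A :: "'a::complex_hilbert_space \<Rightarrow> 'a"
  assumes A: "positive_op A" and contr: "\<And>x. norm (A x) \<le> norm x"
  shows "\<exists>B. positive_op B \<and> B \<circ> B = A"
proof -
  have "bounded_clinear A"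
    using A by (simp add: positive_op_def)
  note blA = bounded_clinearD(1)[OF this] and scA = bounded_clinearD(2)[OF this]
  define C where "C = Blinfun (\<lambda>x. x - A x)"
  have C: "blinfun_apply C = (\<lambda>x. x - A x)"
    unfolding C_def
    by (rule bounded_linear_Blinfun_apply) (intro bounded_linear_sub bounded_linear_ident blA)
  have "norm C \<le> 1"
  proof (rule norm_blinfun_bound)
    fix x
    have "(norm (x - A x))\<^sup>2 \<le> (norm x)\<^sup>2"
      using positive_op_norm_complement[OF A contr, of x] zero_le_power2[of "norm (A x)"] by linarith
    then show "norm (C x) \<le> 1 * norm x"
      using power2_le_imp_le[of "norm (x - A x)" "norm x"] by (simp add: C)
  qed simp
  then obtain Y where lim: "sqrt_iter C \<longlonglongrightarrow> Y"
    using convergent_sqrt_iter by (auto simp: convergent_def)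
  have lim_apply: "(\<lambda>n. sqrt_iter C n x) \<longlonglongrightarrow> Y x" for x
    by (intro blinfun.tendsto lim tendsto_const)
  have "(\<lambda>n. C + (sqrt_iter C n o\<^sub>L sqrt_iter C n)) \<longlonglongrightarrow> C + (Y o\<^sub>L Y)"
    by (intro tendsto_intros lim bounded_bilinear.tendsto[OF bounded_bilinear_blinfun_compose])
  moreover have "(\<lambda>n. 2 *\<^sub>R sqrt_iter C (Suc n)) \<longlonglongrightarrow> 2 *\<^sub>R Y"
    by (intro tendsto_scaleR tendsto_const LIMSEQ_Suc lim)
  moreover have "2 *\<^sub>R sqrt_iter C (Suc n) = C + (sqrt_iter C n o\<^sub>L sqrt_iter C n)" for n
    by simp
  ultimately have fixpoint: "2 *\<^sub>R Y = C + (Y o\<^sub>L Y)"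
    by (simp only: LIMSEQ_unique)
  \<comment> \<open>Elements of the \<open>blinfun\<close> type are only real linear, so complex
    homogeneity is carried through the iteration separately.\<close>
  have sc: "Y (c *\<^sub>C x) = c *\<^sub>C Y x" for c x
  proof -
    have "sqrt_iter C n (c *\<^sub>C x) = c *\<^sub>C sqrt_iter C n x" for n x
      by (induction n arbitrary: x)
        (simp_all add: C scA blinfun.bilinear_simps scaleR_scaleC scaleC_scaleC scaleC_add_right
          complex_vector.scale_right_diff_distrib mult.commute)
    then show ?thesis
      using LIMSEQ_unique[OF lim_apply[of "c *\<^sub>C x"]]
        bounded_linear.tendsto[OF bounded_clinearD(1)[OF bounded_clinear_scaleC] lim_apply] by auto
  qed
  \<comment> \<open>Each iterate is a real polynomial in the self-adjoint \<open>C\<close>, and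
    symmetry survives pointwise limits.\<close>
  have sa: "cinner (Y x) y = cinner x (Y y)" for x y
  proof -
    have "cinner (sqrt_iter C n x) y = cinner x (sqrt_iter C n y)" for n x y
      by (induction n arbitrary: x y)
        (simp_all add: C blinfun.bilinear_simps cinner.scaleR_left cinner.scaleR_right
          cinner_add_left cinner_add_right cinner.diff_left cinner.diff_right positive_op_selfadjoint[OF A])
    then show ?thesis
      using LIMSEQ_unique[OF cinner.tendsto[OF lim_apply[of x] tendsto_const[of y]]]
        cinner.tendsto[OF tendsto_const[of x] lim_apply[of y]] by auto
  qed
  have "norm Y \<le> 1"
    using tendsto_norm[OF lim] norm_sqrt_iter[OF \<open>norm C \<le> 1\<close>] sqrt_bound_bounds(2)
    by (intro LIMSEQ_le_const2) (auto intro: order_trans)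
  define B where "B x = x - Y x" for x
  have "bounded_clinear B"
    unfolding bounded_clinear_def B_def
    by (auto intro: bounded_linear_sub bounded_linear_ident blinfun.bounded_linear_right
        simp: sc complex_vector.scale_right_diff_distrib)
  \<comment> \<open>The form of \<open>B = 1 - Y\<close> is real because \<open>Y\<close> is
    symmetric and nonnegative because \<open>norm Y \<le> 1\<close>.\<close>
  moreover have "cinner (B x) x \<in> \<real>\<^sub>\<ge>\<^sub>0" for x
  proof -
    have "cinner (B x) x = cnj (cinner (B x) x)"
      by (subst cinner_commute) (simp add: B_def cinner.diff_left cinner.diff_right sa)
    then have "Im (cinner (B x) x) = 0"
      by (simp add: complex_eq_iff)
    moreover have "Re (cinner (Y x) x) \<le> (norm x)\<^sup>2"
    proof -
      have "Re (cinner (Y x) x) \<le> norm (Y x) * norm x"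
        by (rule Re_cinner_le)
      also have "norm (Y x) \<le> norm x"
        using order_trans[OF norm_blinfun mult_right_mono[OF \<open>norm Y \<le> 1\<close> norm_ge_zero]] by simp
      then have "norm (Y x) * norm x \<le> norm x * norm x"
        by (simp add: mult_right_mono)
      finally show ?thesis by (simp add: power2_eq_square)
    qed
    ultimately show ?thesis
      by (simp add: complex_nonneg_Reals_iff B_def cinner.diff_left Re_cinner_same)
  qed
  moreover have "B (B x) = A x" for x
  proof -
    have "2 *\<^sub>R Y x = x - A x + Y (Y x)"
      using arg_cong[OF fixpoint, of "\<lambda>Z. blinfun_apply Z x"] by (simp add: C blinfun.bilinear_simps)
    then show ?thesis
      by (simp add: B_def blinfun.bilinear_simps scaleR_2 algebra_simps)
  qed
  ultimately show ?thesis
    by (auto simp: positive_op_def fun_eq_iff intro!: exI[of _ B])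
qed

text \<open>Dividing by a norm bound \<open>K\<close> gives a contraction; its root, multiplied by
  \<open>sqrt K\<close>, is a root of \<open>A\<close>.\<close>

lemma positive_op_sqrt_exists:
  fixes A :: "'a::complex_hilbert_space \<Rightarrow> 'a"
  assumes A: "positive_op A"
  shows "\<exists>B. positive_op B \<and> B \<circ> B = A"
proof -
  obtain K where "0 < K" and K: "\<And>x. norm (A x) \<le> K * norm x"
    using A bounded_clinear_pos_bound unfolding positive_op_def by blast
  have "positive_op (\<lambda>x. (1/K) *\<^sub>R A x)"
    using A \<open>0 < K\<close> by (simp add: positive_op_scaleR)
  moreover have "norm ((1/K) *\<^sub>R A x) \<le> norm x" for x
    using K[of x] \<open>0 < K\<close> by (simp add: field_simps)
  ultimately obtain B where B: "positive_op B" "B \<circ> B = (\<lambda>x. (1/K) *\<^sub>R A x)"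
    using positive_op_sqrt_exists_contraction by blast
  have "linear B"
    using B by (simp add: positive_op_def bounded_clinear_def bounded_linear.linear)
  then have "(\<lambda>x. sqrt K *\<^sub>R B x) \<circ> (\<lambda>x. sqrt K *\<^sub>R B x) = A"
    using \<open>0 < K\<close> fun_cong[OF B(2)] by (auto simp: fun_eq_iff linear_scale)
  then show ?thesis
    using positive_op_scaleR[OF B(1), of "sqrt K"] \<open>0 < K\<close> by auto
qed

lemma op_sqrt:
  fixes A :: "'a::complex_hilbert_space \<Rightarrow> 'a"
  assumes "positive_op A"
  shows "positive_op (op_sqrt A)" and "op_sqrt A (op_sqrt A x) = A x"
proof -
  have "positive_op (op_sqrt A) \<and> op_sqrt A \<circ> op_sqrt A = A"
    unfolding op_sqrt_def using positive_op_sqrt_exists[OF assms] by (rule someI_ex)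
  then show "positive_op (op_sqrt A)" "op_sqrt A (op_sqrt A x) = A x"
    by (auto simp: fun_eq_iff)
qed

section \<open>Invertibility of positive operators that are bounded below\<close>

lemma positive_op_bounded_below_invertible:
  fixes A :: "'a::complex_hilbert_space \<Rightarrow> 'a"
  assumes A: "positive_op A" and "0 < c" and below: "\<And>x. c * norm x \<le> norm (A x)"
  shows "invertible_op A"
proof -
  have bA: "bounded_clinear A"
    using A by (simp add: positive_op_def)
  then have lin: "linear A" and sc: "\<And>c x. A (c *\<^sub>C x) = c *\<^sub>C A x"
    by (auto simp: bounded_clinear_def bounded_linear.linear)
  obtain K where "0 < K" and K: "\<And>x. norm (A x) \<le> K * norm x"
    using bA bounded_clinear_pos_bound by blast
  define A' where "A' x = (1/K) *\<^sub>R A x" for x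
  \<comment> \<open>The cap at 1 keeps \<open>1 - d\<^sup>2\<close> nonnegative even on the zero
    space, where nothing forces \<open>c \<le> K\<close>.\<close>
  define d where "d = min (c / K) 1"
  have d: "0 < d" "d \<le> 1"
    using \<open>0 < c\<close> \<open>0 < K\<close> by (auto simp: d_def)
  have posA': "positive_op A'"
    unfolding A'_def using A \<open>0 < K\<close> by (simp add: positive_op_scaleR)
  have contrA': "norm (A' x) \<le> norm x" for x
    using K[of x] \<open>0 < K\<close> by (simp add: A'_def field_simps)
  have belowA': "d * norm x \<le> norm (A' x)" for x
  proof -
    have "d * norm x \<le> (c / K) * norm x"
      by (intro mult_right_mono) (auto simp: d_def)
    also have "\<dots> \<le> norm (A' x)"
      using below[of x] \<open>0 < K\<close> by (simp add: A'_def divide_right_mono)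
    finally show ?thesis .
  qed
  have contraction: "norm (x - A' x) \<le> sqrt (1 - d\<^sup>2) * norm x" for x
  proof -
    have "(d * norm x)\<^sup>2 \<le> (norm (A' x))\<^sup>2"
      using belowA' d by (simp add: power_mono)
    then have "(norm (x - A' x))\<^sup>2 \<le> (1 - d\<^sup>2) * (norm x)\<^sup>2"
      using positive_op_norm_complement[OF posA' contrA', of x]
      by (simp add: power_mult_distrib left_diff_distrib)
    then have "norm (x - A' x) \<le> sqrt ((1 - d\<^sup>2) * (norm x)\<^sup>2)"
      by (rule real_le_rsqrt)
    then show ?thesis by (simp add: real_sqrt_mult)
  qed
  have surj: "\<exists>x. A x = y" for y
  proof -
    \<comment> \<open>The fixed points of \<open>f\<close> are exactly the solutions of
      \<open>A x = y\<close>, and \<open>f\<close> contracts distances by the factor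
      \<open>sqrt (1 - d\<^sup>2) < 1\<close>.\<close>
    define f where "f x = (1/K) *\<^sub>R y + (x - A' x)" for x
    have "dist (f x) (f z) \<le> sqrt (1 - d\<^sup>2) * dist x z" for x z
      using contraction[of "x - z"]
      by (simp add: dist_norm f_def A'_def linear_diff[OF lin] scaleR_diff_right algebra_simps)
    moreover have "0 \<le> sqrt (1 - d\<^sup>2)" "sqrt (1 - d\<^sup>2) < 1"
      using d by (auto simp: abs_square_le_1)
    ultimately obtain x where "f x = x"
      using banach_fix_type by blast
    then have "(1/K) *\<^sub>R y = (1/K) *\<^sub>R A x"
      by (simp add: f_def A'_def algebra_simps)
    then show ?thesis
      using \<open>0 < K\<close> by auto
  qed
  then obtain B where AB: "\<And>y. A (B y) = y"
    by metis
  have "inj A"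
  proof (rule injI)
    fix x y assume "A x = A y"
    then show "x = y"
      using below[of "x - y"] \<open>0 < c\<close> by (simp add: linear_diff[OF lin] mult_le_0_iff)
  qed
  then have eqI: "\<And>x y. A x = A y \<Longrightarrow> x = y"
    by (simp add: inj_eq)
  have "bounded_linear B"
  proof (rule bounded_linear_intro)
    fix x y and r :: real
    show "B (x + y) = B x + B y"
      by (rule eqI) (simp add: linear_add[OF lin] AB)
    show "B (r *\<^sub>R x) = r *\<^sub>R B x"
      by (rule eqI) (simp add: linear_scale[OF lin] AB)
    show "norm (B x) \<le> norm x * (1 / c)"
      using below[of "B x"] \<open>0 < c\<close> by (simp add: AB field_simps)
  qed
  moreover have "B (c *\<^sub>C x) = c *\<^sub>C B x" for c x
    by (rule eqI) (simp add: sc AB)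
  ultimately have "bounded_clinear B"
    by (simp add: bounded_clinear_def)
  moreover have "B (A x) = x" for x
    by (rule eqI) (simp add: AB)
  ultimately show ?thesis
    using bA AB by (auto simp: invertible_op_def fun_eq_iff)
qed

section \<open>Bounded below operators\<close>

text \<open>Repeatedly replacing \<open>x\<close> by \<open>x - u\<close> converges, and the limit is a zero of \<open>L\<close>.\<close>

lemma bounded_below_if_approximable:
  fixes L :: "'a::banach \<Rightarrow> 'b::real_normed_vector"
  assumes L: "bounded_linear L" and "inj L" and "0 \<le> K"
    and approx: "\<And>x. \<exists>u. norm u \<le> K * norm (L x) \<and> norm (L (x - u)) \<le> norm (L x) / 2"
  shows "norm x \<le> 2 * K * norm (L x)"
proof -
  interpret L: bounded_linear L by fact
  obtain g where g: "\<And>x. norm (g x) \<le> K * norm (L x)" "\<And>x. norm (L (x - g x)) \<le> norm (L x) / 2"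
    using approx by metis
  define X where "X n = ((\<lambda>z. z - g z) ^^ n) x" for n
  define D where "D n = X (Suc n) - X n" for n
  have X_0: "X 0 = x" and X_Suc: "X (Suc n) = X n - g (X n)" for n
    by (simp_all add: X_def)
  have LX: "norm (L (X n)) \<le> norm (L x) * (1/2) ^ n" for n
  proof (induction n)
    case (Suc n)
    then show ?case
      using g(2)[of "X n"] by (simp add: X_Suc)
  qed (simp add: X_0)
  have D: "norm (D n) \<le> K * norm (L x) * (1/2) ^ n" for n
  proof -
    have "norm (D n) \<le> K * norm (L (X n))"
      using g(1)[of "X n"] by (simp add: D_def X_Suc)
    also have "\<dots> \<le> K * (norm (L x) * (1/2) ^ n)"
      using LX \<open>0 \<le> K\<close> by (rule mult_left_mono)
    finally show ?thesis by simp
  qed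
  have geom: "(\<lambda>n. K * norm (L x) * (1/2) ^ n) sums (K * norm (L x) * 2)"
    using sums_mult[OF geometric_sums[of "1/2 :: real"]] by simp
  have "summable (\<lambda>n. norm (D n))"
    using D by (intro summable_comparison_test'[OF sums_summable[OF geom]]) auto
  then have "summable D"
    by (rule summable_norm_cancel)
  have "(\<lambda>n. X 0 + (\<Sum>i<n. D i)) \<longlonglongrightarrow> X 0 + suminf D"
    using \<open>summable D\<close> by (intro tendsto_add tendsto_const summable_LIMSEQ)
  then have "X \<longlonglongrightarrow> x + suminf D"
    unfolding D_def sum_lessThan_telescope by (simp add: X_0)
  then have "(\<lambda>n. L (X n)) \<longlonglongrightarrow> L (x + suminf D)"
    by (rule L.tendsto)
  moreover have "(\<lambda>n. L (X n)) \<longlonglongrightarrow> 0"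
  proof (rule Lim_null_comparison)
    show "\<forall>\<^sub>F n in sequentially. norm (L (X n)) \<le> norm (L x) * (1/2) ^ n"
      using LX by simp
    show "(\<lambda>n. norm (L x) * (1/2) ^ n) \<longlonglongrightarrow> 0"
      by (intro tendsto_mult_right_zero LIMSEQ_power_zero) simp
  qed
  ultimately have "L (x + suminf D) = L 0"
    using LIMSEQ_unique L.zero by metis
  \<comment> \<open>Injectivity gives \<open>x = - suminf D\<close>, so the geometric bound on the
    increments bounds \<open>norm x\<close> itself.\<close>
  then have "x + suminf D = 0"
    by (rule injD[OF \<open>inj L\<close>])
  then have "norm x = norm (suminf D)"
    by (metis add_eq_0_iff norm_minus_cancel)
  also have "\<dots> \<le> (\<Sum>n. norm (D n))"
    using \<open>summable (\<lambda>n. norm (D n))\<close> by (rule summable_norm)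
  also have "\<dots> \<le> (\<Sum>n. K * norm (L x) * (1/2) ^ n)"
    using D \<open>summable (\<lambda>n. norm (D n))\<close> geom by (intro suminf_le) (auto simp: sums_iff)
  also have "\<dots> = 2 * K * norm (L x)"
    using geom by (simp add: sums_iff)
  finally show ?thesis .
qed

text \<open>The closed range is a complete metric space covered by the closures of the images of
  balls of integer radius. By Baire, one closure has interior in the range; differences of points of
  that image near \<open>y0\<close> then give the approximate preimages required by
  \<open>bounded_below_if_approximable\<close>.\<close>

lemma bounded_below_if_inj_closed_range:
  fixes L :: "'a::banach \<Rightarrow> 'b::banach"
  assumes L: "bounded_linear L" and "inj L" and closed: "closed (range L)"
  shows "\<exists>c>0. \<forall>x. c * norm x \<le> norm (L x)"
proof -
  interpret L: bounded_linear L by fact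
  let ?X = "top_of_set (range L)"
  define F where "F n = closure (L ` cball 0 (real n))" for n
  have F_subset: "F n \<subseteq> range L" for n
    unfolding F_def by (intro closure_minimal closed) auto
  have Union_F: "\<Union>(range F) = range L"
  proof
    show "range L \<subseteq> \<Union>(range F)"
    proof (rule image_subsetI)
      fix x :: 'a
      obtain n where "norm x \<le> real n"
        using real_arch_simple by blast
      then have "L x \<in> F n"
        unfolding F_def by (intro subsetD[OF closure_subset]) simp
      then show "L x \<in> \<Union>(range F)" by blast
    qed
  qed (use F_subset in blast)
  have "\<exists>n. ?X interior_of F n \<noteq> {}"
  proof (rule ccontr)
    assume "\<nexists>n. ?X interior_of F n \<noteq> {}"
    moreover have "completely_metrizable_space ?X"
      using closed
      by (intro completely_metrizable_space_closedin completely_metrizable_space_euclidean) simp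
    moreover have "closedin ?X (F n)" for n
      using F_subset[of n] by (simp add: F_def closed_subset)
    ultimately have "?X interior_of \<Union>(range F) = {}"
      by (intro Baire_category_alt) auto
    moreover have "?X interior_of (range L) = range L"
      using interior_of_topspace[of ?X] by simp
    ultimately show False
      using Union_F by simp
  qed
  then obtain n y0 where "y0 \<in> ?X interior_of F n"
    by blast
  then obtain U where U: "openin ?X U" "y0 \<in> U" "U \<subseteq> F n"
    by (auto simp: interior_of_def)
  then obtain r where "0 < r" and r: "ball y0 r \<inter> range L \<subseteq> F n"
    by (meson openin_contains_ball order_trans)
  have "y0 \<in> F n" "y0 \<in> range L"
    using U F_subset by auto
  \<comment> \<open>Below, \<open>u\<close> is a difference of two vectors of norm at most
    \<open>n\<close>, divided by \<open>s = r / (2 * norm (L x))\<close>; its norm is at most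
    \<open>2 * n / s = K * norm (L x)\<close>.\<close>
  define K where "K = 4 * real n / r"
  have "0 \<le> K"
    using \<open>0 < r\<close> by (simp add: K_def)
  have approx: "\<exists>u. norm u \<le> K * norm (L x) \<and> norm (L (x - u)) \<le> norm (L x) / 2" for x
  proof (cases "L x = 0")
    case True
    then show ?thesis by (intro exI[of _ 0]) (simp add: L.zero)
  next
    case False
    \<comment> \<open>This scales \<open>L x\<close> to norm \<open>r / 2\<close>, so that
      \<open>y0 + s *\<^sub>R L x\<close> stays inside the ball.\<close>
    define s where "s = r / (2 * norm (L x))"
    have "0 < s"
      using False \<open>0 < r\<close> by (simp add: s_def)
    have "y0 + s *\<^sub>R L x \<in> range L"
      using \<open>y0 \<in> range L\<close> by (auto simp flip: L.add L.scaleR)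
    moreover have "y0 + s *\<^sub>R L x \<in> ball y0 r"
      using False \<open>0 < r\<close> by (simp add: dist_norm s_def)
    ultimately have "y0 + s *\<^sub>R L x \<in> F n"
      using r by blast
    \<comment> \<open>Two errors below \<open>r / 8\<close> add up to less than
      \<open>r / 4\<close>, which after division by \<open>s\<close> is
      \<open>norm (L x) / 2\<close>.\<close>
    then obtain a where a: "norm a \<le> real n" "norm (L a - (y0 + s *\<^sub>R L x)) < r / 8"
      using \<open>0 < r\<close> unfolding F_def closure_approachable
      by (fastforce simp: dist_norm dest: spec[of _ "r / 8"])
    obtain b where b: "norm b \<le> real n" "norm (L b - y0) < r / 8"
      using \<open>0 < r\<close> \<open>y0 \<in> F n\<close> unfolding F_def closure_approachable
      by (fastforce simp: dist_norm dest: spec[of _ "r / 8"])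
    define u where "u = (1 / s) *\<^sub>R (a - b)"
    have "norm u \<le> (1 / s) * (2 * real n)"
      using \<open>0 < s\<close> a(1) b(1) norm_triangle_ineq4[of a b]
      by (simp add: u_def divide_right_mono)
    also have "\<dots> = K * norm (L x)"
      using False \<open>0 < r\<close> by (simp add: s_def K_def)
    finally have "norm u \<le> K * norm (L x)" .
    moreover have "norm (L (x - u)) \<le> norm (L x) / 2"
    proof -
      have "L (x - u) = (1 / s) *\<^sub>R ((L b - y0) - (L a - (y0 + s *\<^sub>R L x)))"
        using \<open>0 < s\<close> by (simp add: u_def L.diff L.add L.scaleR algebra_simps)
      then have "norm (L (x - u)) = (1 / s) * norm ((L b - y0) - (L a - (y0 + s *\<^sub>R L x)))"
        using \<open>0 < s\<close> by simp
      also have "\<dots> \<le> (1 / s) * (r / 4)"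
        using \<open>0 < s\<close> a(2) b(2) norm_triangle_ineq4[of "L b - y0" "L a - (y0 + s *\<^sub>R L x)"]
        by (intro mult_left_mono) auto
      also have "\<dots> = norm (L x) / 2"
        using False \<open>0 < r\<close> by (simp add: s_def)
      finally show ?thesis .
    qed
    ultimately show ?thesis by blast
  qed
  \<comment> \<open>The summand 1 keeps the denominator positive when \<open>K = 0\<close>, which
    happens for \<open>n = 0\<close>.\<close>
  have "1 / (2 * K + 1) * norm x \<le> norm (L x)" for x
  proof -
    have "norm x \<le> (2 * K + 1) * norm (L x)"
      using bounded_below_if_approximable[OF L \<open>inj L\<close> \<open>0 \<le> K\<close> approx, of x]
      by (simp add: distrib_right add_increasing2)
    then show ?thesis
      using \<open>0 \<le> K\<close> by (simp add: divide_simps mult.commute)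
  qed
  then show ?thesis
    using \<open>0 \<le> K\<close> by (intro exI[of _ "1 / (2 * K + 1)"]) auto
qed

section \<open>Left invertible pairs and the joint modulus\<close>

text \<open>Covers both cases of the theorem: \<open>Q\<close> is \<open>P\<close> for the original
  pair and the square root of \<open>P\<close> for the Aluthge transform. Both components are
  dominated by \<open>Q\<close>, so the lower bound of the column passes to it.\<close>

lemma left_invertible_pair_factor_bounded_below:
  fixes S1 S2 Q :: "'a::complex_hilbert_space \<Rightarrow> 'a"
  assumes "bounded_linear S1" "bounded_linear S2" and left_inv: "left_invertible_pair S1 S2"
    and "0 < K1" "\<And>x. norm (S1 x) \<le> K1 * norm (Q x)"
    and "0 < K2" "\<And>x. norm (S2 x) \<le> K2 * norm (Q x)"
  shows "\<exists>c>0. \<forall>x. c * norm x \<le> norm (Q x)"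
proof -
  have "bounded_linear (column S1 S2)"
    using bounded_linear_Pair[OF assms(1,2)] by (simp add: column_def[abs_def])
  then obtain c where "0 < c" and c: "\<And>x. c * norm x \<le> norm (column S1 S2 x)"
    using bounded_below_if_inj_closed_range left_inv unfolding left_invertible_pair_def by blast
  have "c / (K1 + K2) * norm x \<le> norm (Q x)" for x
  proof -
    have "c * norm x \<le> norm (S1 x) + norm (S2 x)"
      using c[of x] norm_Pair_le[of "S1 x" "S2 x"] by (simp add: column_def)
    also have "\<dots> \<le> (K1 + K2) * norm (Q x)"
      using assms(5,7) by (simp add: distrib_right add_mono)
    finally show ?thesis
      using \<open>0 < K1\<close> \<open>0 < K2\<close> by (simp add: divide_simps mult.commute)
  qed
  then show ?thesis
    using \<open>0 < c\<close> \<open>0 < K1\<close> \<open>0 < K2\<close> by (intro exI[of _ "c / (K1 + K2)"]) simp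
qed

text \<open>Each summand has the form \<open>(norm (T x))\<^sup>2\<close>. Positivity ensures that
  \<open>op_sqrt\<close> in \<open>joint_modulus\<close> picks an actual positive root.\<close>

lemma joint_modulus_gram_positive:
  fixes T1 T2 :: "'a::complex_hilbert_space \<Rightarrow> 'a"
  assumes T: "bounded_clinear T1" "bounded_clinear T2"
  shows "positive_op (\<lambda>x. cadjoint T1 (T1 x) + cadjoint T2 (T2 x))"
proof -
  have "bounded_linear (\<lambda>x. cadjoint T1 (T1 x) + cadjoint T2 (T2 x))"
    by (intro bounded_linear_add T[THEN bounded_clinearD(1)]
        bounded_linear_compose[OF T(1)[THEN bounded_clinear_cadjoint, THEN bounded_clinearD(1)]]
        bounded_linear_compose[OF T(2)[THEN bounded_clinear_cadjoint, THEN bounded_clinearD(1)]])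
  then have "bounded_clinear (\<lambda>x. cadjoint T1 (T1 x) + cadjoint T2 (T2 x))"
    by (simp add: bounded_clinear_def T[THEN bounded_clinearD(2)]
        T[THEN bounded_clinear_cadjoint, THEN bounded_clinearD(2)] scaleC_add_right)
  moreover have "cinner (cadjoint T (T x)) x = complex_of_real ((norm (T x))\<^sup>2)"
    if "bounded_clinear T" for T :: "'a \<Rightarrow> 'a" and x
  proof -
    have "cinner (cadjoint T (T x)) x = cnj (cinner (T x) (T x))"
      unfolding cinner_cadjoint[OF that] by (rule cinner_commute)
    then show ?thesis by (simp add: cinner_norm)
  qed
  ultimately show ?thesis
    using T by (simp add: positive_op_def cinner_add_left complex_nonneg_Reals_iff)
qed

theorem theorem2p1:
  fixes T1 T2 V1 V2 P :: "'a::complex_hilbert_space \<Rightarrow> 'a"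
  assumes infinite_dim: "\<not> (\<exists>B :: 'a set. finite B \<and> cspan B = UNIV)"
    and bounded: "bounded_clinear T1" "bounded_clinear T2"
    and commute: "T1 \<circ> T2 = T2 \<circ> T1"
    and P: "P = joint_modulus T1 T2"
    and polar: "canonical_joint_polar_decomposition T1 T2 V1 V2 P"
    and left_inv: "left_invertible_pair T1 T2 \<or>
      left_invertible_pair (spherical_aluthge P V1) (spherical_aluthge P V2)"
  shows "invertible_op P"
proof -
  have "positive_op P"
    unfolding P joint_modulus_def
    using bounded by (intro op_sqrt(1) joint_modulus_gram_positive)
  have T: "T1 = V1 \<circ> P" "T2 = V2 \<circ> P" and V: "bounded_clinear V1" "bounded_clinear V2"
    using polar unfolding canonical_joint_polar_decomposition_def by blast+
  obtain K1 where K1: "0 < K1" "\<And>x. norm (V1 x) \<le> K1 * norm x"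
    using bounded_clinear_pos_bound[OF V(1)] by blast
  obtain K2 where K2: "0 < K2" "\<And>x. norm (V2 x) \<le> K2 * norm x"
    using bounded_clinear_pos_bound[OF V(2)] by blast
  have "\<exists>c>0. \<forall>x. c * norm x \<le> norm (P x)"
    using left_inv
  proof
    assume left_inv: "left_invertible_pair T1 T2"
    have "norm (T1 x) \<le> K1 * norm (P x)" "norm (T2 x) \<le> K2 * norm (P x)" for x
      using K1(2)[of "P x"] K2(2)[of "P x"] by (simp_all add: T)
    then show ?thesis
      by (rule left_invertible_pair_factor_bounded_below[OF bounded[THEN bounded_clinearD(1)] left_inv
            K1(1) _ K2(1)])
  next
    define R where "R = op_sqrt P"
    assume left_inv: "left_invertible_pair (spherical_aluthge P V1) (spherical_aluthge P V2)"
    have R: "bounded_clinear R"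
      using op_sqrt(1)[OF \<open>positive_op P\<close>] by (simp add: R_def positive_op_def)
    obtain K where K: "0 < K" "\<And>x. norm (R x) \<le> K * norm x"
      using bounded_clinear_pos_bound[OF R] by blast
    have aluthge: "spherical_aluthge P V x = R (V (R x))" for V x
      by (simp add: spherical_aluthge_def R_def)
    \<comment> \<open>The outer root and \<open>V\<close> are absorbed into the constants
      \<open>K\<close> and \<open>k\<close>, leaving the inner root as the common right factor of
      both components.\<close>
    have bound: "norm (spherical_aluthge P V x) \<le> K * k * norm (R x)"
      if "\<And>x. norm (V x) \<le> k * norm x" for V k x
      using order_trans[OF K(2) mult_left_mono[OF that less_imp_le[OF K(1)]], of "R x"]
      unfolding aluthge mult.assoc .
    have linear: "bounded_linear (spherical_aluthge P V)" if "bounded_clinear V" for V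
      unfolding aluthge[abs_def]
      by (rule bounded_linear_compose[OF bounded_clinearD(1)[OF R]
            bounded_linear_compose[OF bounded_clinearD(1)[OF that] bounded_clinearD(1)[OF R]]])
    have "\<exists>c>0. \<forall>x. c * norm x \<le> norm (R x)"
      using K(1) K1(1) K2(1)
      by (intro left_invertible_pair_factor_bounded_below[OF linear[OF V(1)] linear[OF V(2)] left_inv
            _ bound[OF K1(2)] _ bound[OF K2(2)]]) simp_all
    then obtain c where c: "0 < c" "\<And>x. c * norm x \<le> norm (R x)"
      by blast
    have "c * c * norm x \<le> norm (P x)" for x
      using order_trans[OF mult_left_mono[OF c(2) less_imp_le[OF c(1)]] c(2), of x]
      by (simp add: R_def op_sqrt(2)[OF \<open>positive_op P\<close>] mult.assoc)
    then show ?thesis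
      using c(1) by (intro exI[of _ "c * c"]) simp
  qed
  then show ?thesis
    using positive_op_bounded_below_invertible \<open>positive_op P\<close> by blast
qed

end
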